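(* The rule \[ \frac{\Gamma\Rightarrow A\qquad A,\Delta\Rightarrow C}{\Gamma,\Delta\Rightarrow C}\ \mathrm{Cut} \] is admissible in $\mathsf{G0T}^{i}$; that is, whenever both premisses are derivable in $\mathsf{G0T}^{i}$, so is the conclusion.
   Context: Formulae are generated from a countable set of propositional variables by $A ::= p \mid \bot \mid A\land A \mid A\lor A \mid A\to A$. Rules below are written premisses / conclusion. The calculus $\mathsf{G0T}^{i}$. Sequents $\Gamma\Rightarrow C$ with $\Gamma$ a finite multiset and $C$ a formula. Initial sequents: $A\Rightarrow A$ and $\bot\Rightarrow C$ for arbitrary formulae $A,C$. Structural rules: weakening $\Gamma\Rightarrow C$ / $A,\Gamma\Rightarrow C$; contraction $A,A,\Gamma\Rightarrow C$ / $A,\Gamma\Rightarrow C$. Operational rules: - $A,B,\Gamma\Rightarrow C$ / $A\land B,\Gamma\Rightarrow C$. - $A,\Gamma\Rightarrow C$ and $B,\Delta\Rightarrow C$ / $A\lor B,\Gamma,\Delta\Rightarrow C$. - $\Gamma\Rightarrow A$ and $B,\Delta\Rightarrow C$ / $A\to B,\Gamma,\Delta\Rightarrow C$. - $\Gamma\Rightarrow A$ and $\Delta\Rightarrow B$ / $\Gamma,\Delta\Rightarrow A\land B$. - $\Gamma\Rightarrow A$ / $\Gamma\Rightarrow A\lor B$; and $\Gamma\Rightarrow B$ / $\Gamma\Rightarrow A\lor B$. - $A,\Gamma\Rightarrow B$ / $\Gamma\Rightarrow A\to B$. *)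

theory Defs
  imports "HOL-Library.Multiset" "HOL-Library.Countable"
begin

datatype 'v form =
    Var 'v
  | Bot
  | And "'v form" "'v form"  (infixr "\<^bold>\<and>" 68)
  | Or "'v form" "'v form"  (infixr "\<^bold>\<or>" 67)
  | Imp "'v form" "'v form"  (infixr "\<^bold>\<rightarrow>" 66)

text \<open>
  Derivability of the sequent with antecedent multiset \<open>\<Gamma>\<close> and succedent \<open>C\<close>.
  The two-premiss rules have independent contexts, and the initial sequents carry no side
  context, so weakening and contraction are primitive rules.
\<close>

inductive G0Ti :: "'v form multiset \<Rightarrow> 'v form \<Rightarrow> bool"  (infix "\<turnstile>" 55) where
  Ax:   "{#A#} \<turnstile> A"
| BotL: "{#Bot#} \<turnstile> C"
| Wk:   "\<Gamma> \<turnstile> C \<Longrightarrow> {#A#} + \<Gamma> \<turnstile> C"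
| Ctr:  "{#A, A#} + \<Gamma> \<turnstile> C \<Longrightarrow> {#A#} + \<Gamma> \<turnstile> C"
| AndL: "{#A, B#} + \<Gamma> \<turnstile> C \<Longrightarrow> {#A \<^bold>\<and> B#} + \<Gamma> \<turnstile> C"
| OrL:  "{#A#} + \<Gamma> \<turnstile> C \<Longrightarrow> {#B#} + \<Delta> \<turnstile> C \<Longrightarrow> {#A \<^bold>\<or> B#} + \<Gamma> + \<Delta> \<turnstile> C"
| ImpL: "\<Gamma> \<turnstile> A \<Longrightarrow> {#B#} + \<Delta> \<turnstile> C \<Longrightarrow> {#A \<^bold>\<rightarrow> B#} + \<Gamma> + \<Delta> \<turnstile> C"
| AndR: "\<Gamma> \<turnstile> A \<Longrightarrow> \<Delta> \<turnstile> B \<Longrightarrow> \<Gamma> + \<Delta> \<turnstile> A \<^bold>\<and> B"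
| OrR1: "\<Gamma> \<turnstile> A \<Longrightarrow> \<Gamma> \<turnstile> A \<^bold>\<or> B"
| OrR2: "\<Gamma> \<turnstile> B \<Longrightarrow> \<Gamma> \<turnstile> A \<^bold>\<or> B"
| ImpR: "{#A#} + \<Gamma> \<turnstile> B \<Longrightarrow> \<Gamma> \<turnstile> A \<^bold>\<rightarrow> B"

end

theory Submission
  imports Defs
begin

text \<open>
  Because weakening and contraction are rules, derivability depends only on the set of formulas
  in the antecedent. The proof therefore passes to a calculus \<open>S \<tturnstile> C\<close> whose antecedents are sets:
  there the structural rules disappear, all premisses share their context, and a left rule keeps
  its principal formula. The translations are \<open>set_derivable_of_derivable\<close> and
  \<open>derivable_of_set_derivable\<close>.

  With sets, a cut on \<open>A\<close> removes all occurrences of \<open>A\<close> at once, so contraction on the cut formula,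
  the usual obstacle to permuting Cut upwards, causes no trouble. What remains is Gentzen's
  argument (\<open>set_cut\<close>): by induction on the cut formula, and inside it on the derivation
  of the right premiss, the cut moves up the right premiss until \<open>A\<close> is principal in a left
  rule. At that point the derivation of the left premiss is traced up through its left rules, which
  commute with the cut, to the places where \<open>A\<close> is an axiom formula or is introduced on the right
  (\<open>trace_succedent\<close>). In the former case the left rule can be applied again; in the latter
  case the cut splits into cuts on the immediate subformulas of \<open>A\<close>.
\<close>

section \<open>Sequents with sets as antecedents\<close>

inductive set_derivable :: "'v form set \<Rightarrow> 'v form \<Rightarrow> bool"  (infix "\<tturnstile>" 55) where
  SAx:   "A \<in> S \<Longrightarrow> S \<tturnstile> A"
| SBotL: "Bot \<in> S \<Longrightarrow> S \<tturnstile> C"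
| SAndL: "A \<^bold>\<and> B \<in> S \<Longrightarrow> insert A (insert B S) \<tturnstile> C \<Longrightarrow> S \<tturnstile> C"
| SOrL:  "A \<^bold>\<or> B \<in> S \<Longrightarrow> insert A S \<tturnstile> C \<Longrightarrow> insert B S \<tturnstile> C \<Longrightarrow> S \<tturnstile> C"
| SImpL: "A \<^bold>\<rightarrow> B \<in> S \<Longrightarrow> S \<tturnstile> A \<Longrightarrow> insert B S \<tturnstile> C \<Longrightarrow> S \<tturnstile> C"
| SAndR: "S \<tturnstile> A \<Longrightarrow> S \<tturnstile> B \<Longrightarrow> S \<tturnstile> A \<^bold>\<and> B"
| SOrR1: "S \<tturnstile> A \<Longrightarrow> S \<tturnstile> A \<^bold>\<or> B"
| SOrR2: "S \<tturnstile> B \<Longrightarrow> S \<tturnstile> A \<^bold>\<or> B"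
| SImpR: "insert A S \<tturnstile> B \<Longrightarrow> S \<tturnstile> A \<^bold>\<rightarrow> B"

lemma set_derivable_mono:
  "S \<tturnstile> C \<Longrightarrow> S \<subseteq> T \<Longrightarrow> T \<tturnstile> C"
proof (induction arbitrary: T rule: set_derivable.induct)
  case (SAndL A B S C)
  show ?case
    by (rule set_derivable.SAndL[of A B], use SAndL in blast, rule SAndL.IH)
      (use SAndL.prems in blast)
next
  case (SOrL A B S C)
  show ?case
    by (rule set_derivable.SOrL[of A B], use SOrL in blast, (rule SOrL.IH; use SOrL.prems in blast)+)
next
  case (SImpL A B S C)
  show ?case
    by (rule set_derivable.SImpL[of A B], use SImpL in blast, (rule SImpL.IH; use SImpL.prems in blast)+)
next
  case (SImpR A S B)
  show ?case
    by (rule set_derivable.SImpR, rule SImpR.IH) (use SImpR.prems in blast)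
qed (auto intro: set_derivable.SAx set_derivable.SBotL set_derivable.SAndR
      set_derivable.SOrR1 set_derivable.SOrR2)

lemma set_derivable_of_derivable:
  "\<Gamma> \<turnstile> C \<Longrightarrow> set_mset \<Gamma> \<tturnstile> C"
proof (induction rule: G0Ti.induct)
  case (Wk \<Gamma> C A)
  from Wk.IH show ?case by (rule set_derivable_mono) auto
next
  case (AndL A B \<Gamma> C)
  show ?case
    by (rule SAndL[of A B], simp, rule set_derivable_mono[OF AndL.IH]) auto
next
  case (OrL A \<Gamma> C B \<Delta>)
  show ?case
    by (rule SOrL[of A B], simp, rule set_derivable_mono[OF OrL.IH(1)], force,
        rule set_derivable_mono[OF OrL.IH(2)]) auto
next
  case (ImpL \<Gamma> A B \<Delta> C)
  show ?case
    by (rule SImpL[of A B], simp, rule set_derivable_mono[OF ImpL.IH(1)], force,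
        rule set_derivable_mono[OF ImpL.IH(2)]) auto
next
  case (AndR \<Gamma> A \<Delta> B)
  from AndR.IH show ?case
    by (intro SAndR) (erule set_derivable_mono, simp)+
qed (simp_all add: SAx SBotL SOrR1 SOrR2 SImpR)

lemma weakening_many: "\<Gamma> \<turnstile> C \<Longrightarrow> \<Delta> + \<Gamma> \<turnstile> C"
proof (induction \<Delta>)
  case (add A \<Delta>)
  then show ?case using Wk[of "\<Delta> + \<Gamma>" C A] by simp
qed simp

lemma contraction_member:
  assumes "A \<in># \<Gamma>" and "{#A#} + \<Gamma> \<turnstile> C"
  shows "\<Gamma> \<turnstile> C"
proof -
  obtain \<Gamma>' where \<Gamma>: "\<Gamma> = {#A#} + \<Gamma>'"
    using multi_member_split[OF assms(1)] by auto
  then have "{#A, A#} + \<Gamma>' \<turnstile> C" using assms(2) by simp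
  then show ?thesis unfolding \<Gamma> by (rule Ctr)
qed

lemma contraction_many:
  "\<Delta> + \<Gamma> \<turnstile> C \<Longrightarrow> set_mset \<Delta> \<subseteq> set_mset \<Gamma> \<Longrightarrow> \<Gamma> \<turnstile> C"
proof (induction \<Delta>)
  case (add A \<Delta>)
  have A: "A \<in># \<Delta> + \<Gamma>" and \<Delta>: "set_mset \<Delta> \<subseteq> set_mset \<Gamma>"
    using add.prems(2) by simp_all
  have "{#A#} + (\<Delta> + \<Gamma>) \<turnstile> C"
    using add.prems(1) by simp
  with A have "\<Delta> + \<Gamma> \<turnstile> C" by (rule contraction_member)
  then show ?case using \<Delta> by (rule add.IH)
qed simp

lemma derivable_set_mono:
  assumes "\<Gamma> \<turnstile> C" and "set_mset \<Gamma> \<subseteq> set_mset \<Delta>"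
  shows "\<Delta> \<turnstile> C"
proof -
  have "\<Gamma> + \<Delta> \<turnstile> C"
    using weakening_many[OF assms(1), of \<Delta>] by (simp only: add.commute)
  then show ?thesis using assms(2) by (rule contraction_many)
qed

text \<open>
  Quantifying over every \<open>\<Gamma>\<close> with support \<open>S\<close>, instead of choosing one for each \<open>S\<close>, matters for the
  induction: a premiss with antecedent \<open>insert A S\<close> is needed at \<open>{#A#} + \<Gamma>\<close>, where \<open>A\<close> may have
  multiplicity above one. The rules with independent contexts then produce copies of \<open>\<Gamma>\<close>, and
  \<open>derivable_set_mono\<close> contracts them.
\<close>

lemma derivable_of_set_derivable:
  "S \<tturnstile> C \<Longrightarrow> set_mset \<Gamma> = S \<Longrightarrow> \<Gamma> \<turnstile> C"
proof (induction arbitrary: \<Gamma> rule: set_derivable.induct)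
  case (SAx A S)
  show ?case by (rule derivable_set_mono[OF Ax]) (use SAx in simp)
next
  case (SBotL S C)
  show ?case by (rule derivable_set_mono[OF BotL]) (use SBotL in simp)
next
  case (SAndL A B S C)
  then have "{#A, B#} + \<Gamma> \<turnstile> C" by simp
  from AndL[OF this] show ?case by (rule derivable_set_mono) (use SAndL in auto)
next
  case (SOrL A B S C)
  then have "{#A#} + \<Gamma> \<turnstile> C" "{#B#} + \<Gamma> \<turnstile> C" by simp_all
  from OrL[OF this] show ?case by (rule derivable_set_mono) (use SOrL in auto)
next
  case (SImpL A B S C)
  then have "\<Gamma> \<turnstile> A" "{#B#} + \<Gamma> \<turnstile> C" by simp_all
  from ImpL[OF this] show ?case by (rule derivable_set_mono) (use SImpL in auto)
next
  case (SAndR S A B)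
  then have "\<Gamma> \<turnstile> A" "\<Gamma> \<turnstile> B" by simp_all
  from AndR[OF this] show ?case by (rule derivable_set_mono) simp
next
  case (SImpR A S B)
  then have "{#A#} + \<Gamma> \<turnstile> B" by simp
  then show ?case by (rule ImpR)
next
  case (SOrR1 S A B)
  show ?case by (rule OrR1, rule SOrR1.IH[OF SOrR1.prems])
next
  case (SOrR2 S B A)
  show ?case by (rule OrR2, rule SOrR2.IH[OF SOrR2.prems])
qed

section \<open>Cut\<close>

fun right_introducible :: "'v form set \<Rightarrow> 'v form \<Rightarrow> bool" where
  "right_introducible S (A \<^bold>\<and> B) \<longleftrightarrow> S \<tturnstile> A \<and> S \<tturnstile> B"
| "right_introducible S (A \<^bold>\<or> B) \<longleftrightarrow> S \<tturnstile> A \<or> S \<tturnstile> B"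
| "right_introducible S (A \<^bold>\<rightarrow> B) \<longleftrightarrow> insert A S \<tturnstile> B"
| "right_introducible S _ \<longleftrightarrow> False"

text \<open>
  Left rules leave the succedent alone and only enlarge the antecedent on the way up. So in the
  part of a derivation of \<open>S \<tturnstile> A\<close> that is reached from its root through left rules, \<open>A\<close> can be
  replaced by \<open>C\<close>, provided that the sequents at which this part ends become derivable. The minor
  premiss of an implication rule has a succedent of its own and is kept as it is.
\<close>

lemma trace_succedent:
  assumes "S \<tturnstile> A"
    and "\<And>T. S \<subseteq> T \<Longrightarrow> A \<in> T \<or> right_introducible T A \<Longrightarrow> T \<tturnstile> C"
  shows "S \<tturnstile> C"
  using assms
proof (induction rule: set_derivable.induct)
  case (SAx A S)
  show ?case by (rule SAx.prems) (simp_all add: SAx.hyps)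
next
  case (SBotL S D)
  show ?case by (rule set_derivable.SBotL) (rule SBotL.hyps)
next
  case (SAndL A B S D)
  have "insert A (insert B S) \<tturnstile> C"
    by (rule SAndL.IH, rule SAndL.prems) auto
  with SAndL.hyps(1) show ?case by (rule set_derivable.SAndL)
next
  case (SOrL A B S D)
  have "insert A S \<tturnstile> C" "insert B S \<tturnstile> C"
    by (rule SOrL.IH, rule SOrL.prems; auto)+
  with SOrL.hyps(1) show ?case by (rule set_derivable.SOrL)
next
  case (SImpL A B S D)
  have "insert B S \<tturnstile> C"
    by (rule SImpL.IH(2), rule SImpL.prems) auto
  with SImpL.hyps(1,2) show ?case by (rule set_derivable.SImpL)
next
  case (SAndR S A B)
  show ?case by (rule SAndR.prems) (simp_all add: SAndR.hyps)
next
  case (SOrR1 S A B)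
  show ?case by (rule SOrR1.prems) (simp_all add: SOrR1.hyps)
next
  case (SOrR2 S B A)
  show ?case by (rule SOrR2.prems) (simp_all add: SOrR2.hyps)
next
  case (SImpR A S B)
  show ?case by (rule SImpR.prems) (simp_all add: SImpR.hyps)
qed

text \<open>
  Now the cuts in which the last step of the right premiss is a left rule that acts on the cut
  formula. For falsum that step is an axiom, and the left premiss alone decides the matter: \<open>Bot\<close>
  cannot be introduced on the right, so every trace ends at a sequent with \<open>Bot\<close> in its antecedent.
\<close>

lemma principal_cut_Bot:
  assumes "S \<tturnstile> Bot"
  shows "S \<tturnstile> C"
  using assms by (rule trace_succedent) (auto intro: SBotL)

text \<open>
  In the other three cases the premisses of that left rule are assumed with the cut formula
  already removed from their antecedents, and cuts on the immediate subformulas are assumed.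
  For implication the cut on \<open>A\<close> has succedent \<open>B\<close> instead of \<open>C\<close>, so \<open>cutA\<close> is needed for
  every succedent.
\<close>

lemma principal_cut_And:
  assumes cutA: "\<And>T. T \<tturnstile> A \<Longrightarrow> insert A T \<tturnstile> C \<Longrightarrow> T \<tturnstile> C"
    and cutB: "\<And>T. T \<tturnstile> B \<Longrightarrow> insert B T \<tturnstile> C \<Longrightarrow> T \<tturnstile> C"
    and "S \<tturnstile> A \<^bold>\<and> B" and prem: "insert A (insert B S) \<tturnstile> C"
  shows "S \<tturnstile> C"
  using assms(3)
proof (rule trace_succedent)
  fix T assume "S \<subseteq> T" and T: "A \<^bold>\<and> B \<in> T \<or> right_introducible T (A \<^bold>\<and> B)"
  have C: "insert A (insert B T) \<tturnstile> C"
    by (rule set_derivable_mono[OF prem]) (use \<open>S \<subseteq> T\<close> in blast)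
  show "T \<tturnstile> C"
    using T
  proof
    assume "right_introducible T (A \<^bold>\<and> B)"
    then have A: "insert B T \<tturnstile> A" and B: "T \<tturnstile> B"
      using set_derivable_mono[of T A "insert B T"] by (simp_all add: subset_insertI)
    show ?thesis using cutB[OF B cutA[OF A C]] .
  qed (rule SAndL[OF _ C])
qed

lemma principal_cut_Or:
  assumes cutA: "\<And>T. T \<tturnstile> A \<Longrightarrow> insert A T \<tturnstile> C \<Longrightarrow> T \<tturnstile> C"
    and cutB: "\<And>T. T \<tturnstile> B \<Longrightarrow> insert B T \<tturnstile> C \<Longrightarrow> T \<tturnstile> C"
    and "S \<tturnstile> A \<^bold>\<or> B" and prems: "insert A S \<tturnstile> C" "insert B S \<tturnstile> C"
  shows "S \<tturnstile> C"
  using assms(3)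
proof (rule trace_succedent)
  fix T assume "S \<subseteq> T" and T: "A \<^bold>\<or> B \<in> T \<or> right_introducible T (A \<^bold>\<or> B)"
  have C: "insert A T \<tturnstile> C" "insert B T \<tturnstile> C"
    by (rule prems[THEN set_derivable_mono]; use \<open>S \<subseteq> T\<close> in blast)+
  show "T \<tturnstile> C"
    using T cutA[OF _ C(1)] cutB[OF _ C(2)] SOrL[OF _ C]
    unfolding right_introducible.simps by argo
qed

lemma principal_cut_Imp:
  assumes cutA: "\<And>T D. T \<tturnstile> A \<Longrightarrow> insert A T \<tturnstile> D \<Longrightarrow> T \<tturnstile> D"
    and cutB: "\<And>T. T \<tturnstile> B \<Longrightarrow> insert B T \<tturnstile> C \<Longrightarrow> T \<tturnstile> C"
    and "S \<tturnstile> A \<^bold>\<rightarrow> B" and prems: "S \<tturnstile> A" "insert B S \<tturnstile> C"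
  shows "S \<tturnstile> C"
  using assms(3)
proof (rule trace_succedent)
  fix T assume "S \<subseteq> T" and T: "A \<^bold>\<rightarrow> B \<in> T \<or> right_introducible T (A \<^bold>\<rightarrow> B)"
  have A: "T \<tturnstile> A" and C: "insert B T \<tturnstile> C"
    by (rule prems[THEN set_derivable_mono]; use \<open>S \<subseteq> T\<close> in blast)+
  show "T \<tturnstile> C"
    using T cutB[OF cutA[OF A] C] SImpL[OF _ A C]
    unfolding right_introducible.simps by argo
qed

text \<open>
  The variable \<open>S\<close>, related to \<open>T\<close> only by inclusion, serves the induction on the right premiss:
  both sets grow along a branch of that derivation. A left rule whose principal formula lies in
  \<open>T\<close> is repeated below the cut; otherwise that formula is \<open>A\<close>, and the cut is principal.
\<close>

lemma set_cut:
  fixes A :: "'v form"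
  assumes "T \<tturnstile> A" and "S \<tturnstile> C" and "S \<subseteq> insert A T"
  shows "T \<tturnstile> C"
  using assms
proof (induction A arbitrary: S T C rule: measure_induct_rule[of size])
  case (less A)
  have cut: "U \<tturnstile> D" if "size B < size A" "U \<tturnstile> B" "insert B U \<tturnstile> D"
    for B :: "'v form" and U D
    by (rule less.IH[OF that]) simp
  from less.prems(2,1,3) show ?case
  proof (induction arbitrary: T rule: set_derivable.induct)
    case (SAx D S)
    then show ?case by (cases "D = A") (auto intro: set_derivable.SAx)
  next
    case (SBotL S C)
    then have "T \<tturnstile> Bot" by (cases "A = Bot") (auto intro: set_derivable.SAx)
    then show ?case by (rule principal_cut_Bot)
  next
    case (SAndL X Y S C)
    have C: "insert X (insert Y T) \<tturnstile> C"
      by (rule SAndL.IH; (rule set_derivable_mono[OF SAndL.prems(1)])?)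
        (use SAndL.prems(2) in blast)+
    show ?case
    proof (cases "X \<^bold>\<and> Y \<in> T")
      case False
      then have A: "A = X \<^bold>\<and> Y"
        using SAndL.hyps(1) SAndL.prems(2) by auto
      then have size: "size X < size A" "size Y < size A" by simp_all
      have T: "T \<tturnstile> X \<^bold>\<and> Y"
        using SAndL.prems(1) unfolding A .
      show ?thesis
        by (rule principal_cut_And[OF cut[OF size(1)] cut[OF size(2)] T C])
    qed (rule set_derivable.SAndL[OF _ C])
  next
    case (SOrL X Y S C)
    have C: "insert X T \<tturnstile> C" "insert Y T \<tturnstile> C"
      by (rule SOrL.IH; (rule set_derivable_mono[OF SOrL.prems(1)])?; use SOrL.prems(2) in blast)+
    show ?case
    proof (cases "X \<^bold>\<or> Y \<in> T")
      case False
      then have A: "A = X \<^bold>\<or> Y"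
        using SOrL.hyps(1) SOrL.prems(2) by auto
      then have size: "size X < size A" "size Y < size A" by simp_all
      have T: "T \<tturnstile> X \<^bold>\<or> Y"
        using SOrL.prems(1) unfolding A .
      show ?thesis
        by (rule principal_cut_Or[OF cut[OF size(1)] cut[OF size(2)] T C])
    qed (rule set_derivable.SOrL[OF _ C])
  next
    case (SImpL X Y S C)
    have X: "T \<tturnstile> X"
      using SImpL.prems by (rule SImpL.IH(1))
    have C: "insert Y T \<tturnstile> C"
      by (rule SImpL.IH(2); (rule set_derivable_mono[OF SImpL.prems(1)])?)
        (use SImpL.prems(2) in blast)+
    show ?case
    proof (cases "X \<^bold>\<rightarrow> Y \<in> T")
      case False
      then have A: "A = X \<^bold>\<rightarrow> Y"
        using SImpL.hyps(1) SImpL.prems(2) by auto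
      then have size: "size X < size A" "size Y < size A" by simp_all
      have T: "T \<tturnstile> X \<^bold>\<rightarrow> Y"
        using SImpL.prems(1) unfolding A .
      show ?thesis
        by (rule principal_cut_Imp[OF cut[OF size(1)] cut[OF size(2)] T X C])
    qed (rule set_derivable.SImpL[OF _ X C])
  next
    case (SImpR X S Y)
    have "insert X T \<tturnstile> Y"
      by (rule SImpR.IH; (rule set_derivable_mono[OF SImpR.prems(1)])?)
        (use SImpR.prems(2) in blast)+
    then show ?case by (rule set_derivable.SImpR)
  next
    case (SAndR S X Y)
    show ?case by (rule set_derivable.SAndR; rule SAndR.IH[OF SAndR.prems])
  next
    case (SOrR1 S X Y)
    show ?case by (rule set_derivable.SOrR1, rule SOrR1.IH[OF SOrR1.prems])
  next
    case (SOrR2 S Y X)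
    show ?case by (rule set_derivable.SOrR2, rule SOrR2.IH[OF SOrR2.prems])
  qed
qed

theorem theorem6p3:
  fixes \<Gamma> \<Delta> :: "('v :: countable) form multiset" and A C :: "'v form"
  assumes "\<Gamma> \<turnstile> A" and "{#A#} + \<Delta> \<turnstile> C"
  shows "\<Gamma> + \<Delta> \<turnstile> C"
proof (rule derivable_of_set_derivable[OF set_cut refl])
  show "set_mset (\<Gamma> + \<Delta>) \<tturnstile> A"
    using set_derivable_of_derivable[OF assms(1)] by (rule set_derivable_mono) simp
  show "set_mset ({#A#} + \<Delta>) \<tturnstile> C"
    using assms(2) by (rule set_derivable_of_derivable)
  show "set_mset ({#A#} + \<Delta>) \<subseteq> insert A (set_mset (\<Gamma> + \<Delta>))"
    by auto
qed

end
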